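(* Let $\mathcal A$ be a finite alphabet, let $\Sigma_+\subset\mathcal A^{\mathbb N}$ be a subshift and let $\Sigma\subset\mathcal A^{\mathbb Z}$ be its natural extension. Let $S\subset\Sigma_+$. If $\mu$ is a $\sigma$-invariant Borel probability measure on $\Sigma$ which is shadowed by $S$, then $$h(\sigma,\mu)\le h_{\mathrm{top}}(S,\sigma),$$ where $h(\sigma,\mu)$ is the Kolmogorov–Sinai entropy and $h_{\mathrm{top}}(S,\sigma)=\limsup_{n\to\infty}\frac1n\log\#\{A_0\dots A_n:A\in S\}$.
   Context: A (one-sided) subshift $\Sigma_+\subset\mathcal A^{\mathbb N}$ is a closed subset invariant under the left shift $\sigma$, $(\sigma A)_n=A_{n+1}$. Its natural extension is $\Sigma=\{A\in\mathcal A^{\mathbb Z}:\forall p\in\mathbb Z,\ A_pA_{p+1}\dots\in\Sigma_+\}$ with the (invertible) left shift, also denoted $\sigma$. Given $S\subset\Sigma_+$ (not assumed shift-invariant or closed), a sequence $A\in\Sigma$ is shadowed by $S$ if there exist arbitrarily large integers $n$ such that the word $A_{-n}\dots A_0$ is the beginning (initial segment) of some sequence in $S$. A measure $\mu$ on $\Sigma$ is shadowed by $S$ if $\mu$-almost every sequence in $\Sigma$ is shadowed by $S$. *)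

theory Defs
  imports "HOL-Probability.Probability"
begin

subsection \<open>Subshifts and natural extensions\<close>

text \<open>
  The alphabet is a finite type \<open>'a\<close>. One-sided sequences are functions \<open>nat \<Rightarrow> 'a\<close>, two-sided
  sequences are functions \<open>int \<Rightarrow> 'a\<close>; both carry the product of the discrete topologies.
\<close>

definition left_shift :: "('i::semiring_1 \<Rightarrow> 'a) \<Rightarrow> 'i \<Rightarrow> 'a" where
  "left_shift A = (\<lambda>n. A (n + 1))"

definition sequence_topology :: "('i \<Rightarrow> 'a) topology" where
  "sequence_topology = product_topology (\<lambda>_. discrete_topology UNIV) UNIV"

text \<open>
  Invariance of a one-sided subshift means forward invariance; surjectivity of the shift is not
  required.
\<close>

definition subshift :: "(nat \<Rightarrow> 'a) set \<Rightarrow> bool" where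
  "subshift X \<longleftrightarrow> closedin sequence_topology X \<and> left_shift ` X \<subseteq> X"

definition natural_extension :: "(nat \<Rightarrow> 'a) set \<Rightarrow> (int \<Rightarrow> 'a) set" where
  "natural_extension X = {A. \<forall>p. (\<lambda>k. A (p + int k)) \<in> X}"

subsection \<open>Invariant Borel measures\<close>

definition borel_sigma :: "'b topology \<Rightarrow> 'b measure" where
  "borel_sigma X = sigma (topspace X) {U. openin X U}"

definition borel_probability_on :: "'b topology \<Rightarrow> 'b measure \<Rightarrow> bool" where
  "borel_probability_on X M \<longleftrightarrow> prob_space M \<and> sets M = sets (borel_sigma X)"

definition invariant_measure :: "('b \<Rightarrow> 'b) \<Rightarrow> 'b measure \<Rightarrow> bool" where
  "invariant_measure T M \<longleftrightarrow>
     T \<in> measurable M M \<and> (\<forall>B\<in>sets M. emeasure M (T -` B \<inter> space M) = emeasure M B)"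

subsection \<open>Kolmogorov--Sinai entropy\<close>

text \<open>The convention \<open>0 log 0 = 0\<close> holds because of the factor \<open>measure M B\<close>.\<close>

definition partition_entropy :: "'b measure \<Rightarrow> 'b set set \<Rightarrow> real" where
  "partition_entropy M P = - (\<Sum>B\<in>P. measure M B * ln (measure M B))"

definition finite_measurable_partition :: "'b measure \<Rightarrow> 'b set set \<Rightarrow> bool" where
  "finite_measurable_partition M P \<longleftrightarrow> finite P \<and> P \<subseteq> sets M \<and> partition_on (space M) P"

definition pullback_partition :: "'b measure \<Rightarrow> ('b \<Rightarrow> 'b) \<Rightarrow> 'b set set \<Rightarrow> 'b set set" where
  "pullback_partition M T P = (\<lambda>B. T -` B \<inter> space M) ` P - {{}}"

text \<open>The join of \<open>P\<close>, \<open>T\<^sup>-\<^sup>1 P\<close>, \dots, \<open>T\<^sup>-\<^sup>(\<^sup>n\<^sup>-\<^sup>1\<^sup>) P\<close>; only \<open>n > 0\<close> matters.\<close>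

definition iterated_partition ::
    "'b measure \<Rightarrow> ('b \<Rightarrow> 'b) \<Rightarrow> 'b set set \<Rightarrow> nat \<Rightarrow> 'b set set" where
  "iterated_partition M T P n =
     common_refinement ((\<lambda>i. pullback_partition M (T ^^ i) P) ` {..<n})"

text \<open>The limit exists for every invariant probability measure, by subadditivity.\<close>

definition entropy_of_partition :: "'b measure \<Rightarrow> ('b \<Rightarrow> 'b) \<Rightarrow> 'b set set \<Rightarrow> real" where
  "entropy_of_partition M T P =
     lim (\<lambda>n. partition_entropy M (iterated_partition M T P n) / real n)"

definition KS_entropy :: "('b \<Rightarrow> 'b) \<Rightarrow> 'b measure \<Rightarrow> ereal" where
  "KS_entropy T M =
     (SUP P\<in>{P. finite_measurable_partition M P}. ereal (entropy_of_partition M T P))"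

subsection \<open>Shadowing and topological entropy of a set of sequences\<close>

definition shadowed_by :: "(nat \<Rightarrow> 'a) set \<Rightarrow> (int \<Rightarrow> 'a) \<Rightarrow> bool" where
  "shadowed_by S A \<longleftrightarrow> (\<forall>N. \<exists>n\<ge>N. \<exists>B\<in>S. \<forall>k\<le>n. B k = A (int k - int n))"

definition measure_shadowed_by :: "(nat \<Rightarrow> 'a) set \<Rightarrow> (int \<Rightarrow> 'a) measure \<Rightarrow> bool" where
  "measure_shadowed_by S M \<longleftrightarrow> (AE A in M. shadowed_by S A)"

definition initial_words :: "(nat \<Rightarrow> 'a) set \<Rightarrow> nat \<Rightarrow> 'a list set" where
  "initial_words S n = (\<lambda>A. map A [0..<Suc n]) ` S"

text \<open>
  As \<open>ln 0 = 0\<close>, this is \<open>0\<close> rather than \<open>-\<infinity>\<close> for \<open>S = {}\<close>. The empty set shadows no sequence,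
  hence no probability measure.
\<close>

definition htop :: "(nat \<Rightarrow> 'a) set \<Rightarrow> ereal" where
  "htop S = limsup (\<lambda>n. ereal (1 / real n * ln (real (card (initial_words S n)))))"

end

theory Submission
  imports Defs
begin

text \<open>
  Coding argument. By Gibbs' inequality, the entropy of a random word is at most the expectation of
  \<open>- ln q\<close> of that word, for every sub-probability \<open>q\<close> on words. Fix \<open>h > htop S\<close>. Most positions of a
  typical orbit segment are the right end of an initial block of \<open>S\<close> of bounded length, so, parsing
  from the right, the segment is cut into such blocks and a few single letters. Since there are at
  most \<open>exp (h k)\<close> long initial blocks with last index \<open>k\<close>, giving each of them weight slightly less
  than \<open>exp (- h k)\<close> and each letter a fixed small weight produces a sub-probability under which a
  segment of length \<open>N\<close> typically has weight at least \<open>exp (- (h + \<epsilon>) N)\<close>. An arbitrary partition is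
  approximated by one that depends on finitely many coordinates; the itinerary is then guessed from
  the letters, and rare wrong guesses are paid for through a noisy channel. Thus all finite
  partitions are treated at once, without conditional entropy or the generator theorem.
\<close>

subsection \<open>Words\<close>

definition words :: "'a set \<Rightarrow> nat \<Rightarrow> 'a list set" where
  "words A n = {xs. set xs \<subseteq> A \<and> length xs = n}"

lemma finite_words: "finite A \<Longrightarrow> finite (words A n)"
  by (simp add: words_def finite_lists_length_eq)

lemma words_0 [simp]: "words A 0 = {[]}"
  by (auto simp: words_def)

lemma sum_words_add:
  fixes f :: "'a list \<Rightarrow> 'b::comm_monoid_add"
  shows "(\<Sum>w\<in>words A (m + n). f w) = (\<Sum>u\<in>words A m. \<Sum>v\<in>words A n. f (u @ v))"
proof -
  have "(\<Sum>u\<in>words A m. \<Sum>v\<in>words A n. f (u @ v))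
      = (\<Sum>(u, v)\<in>words A m \<times> words A n. f (u @ v))"
    by (simp add: sum.cartesian_product)
  also have "\<dots> = (\<Sum>w\<in>words A (m + n). f w)"
    by (rule sum.reindex_bij_witness[where j = "\<lambda>(u, v). u @ v" and i = "\<lambda>w. (take m w, drop m w)"])
       (auto simp: words_def dest: in_set_takeD in_set_dropD)
  finally show ?thesis by simp
qed

lemma sum_words_Suc:
  fixes f :: "'a list \<Rightarrow> 'b::comm_monoid_add"
  shows "(\<Sum>w\<in>words A (Suc n). f w) = (\<Sum>a\<in>A. \<Sum>v\<in>words A n. f (a # v))"
proof -
  have "(\<Sum>w\<in>words A (Suc 0). g w) = (\<Sum>a\<in>A. g [a])" for g :: "'a list \<Rightarrow> 'b"
    by (rule sum.reindex_bij_witness[where j = hd and i = "\<lambda>a. [a]"])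
       (auto simp: words_def length_Suc_conv)
  then show ?thesis
    using sum_words_add[of f A "Suc 0" n] by simp
qed

text \<open>Reading \<open>\<kappa> a b\<close> as the probability that a memoryless channel turns
  input \<open>b\<close> into output \<open>a\<close>, the total mass of the outputs factors over
  the letters. This normalises the noisy channel used for the itineraries.\<close>

lemma sum_words_prod_le_1:
  fixes \<kappa> :: "'a \<Rightarrow> 'b \<Rightarrow> real"
  assumes "\<And>b. (\<Sum>a\<in>A. \<kappa> a b) \<le> 1" "\<And>a b. \<kappa> a b \<ge> 0"
  shows "(\<Sum>w\<in>words A n. \<Prod>i<n. \<kappa> (w ! i) (c i)) \<le> 1"
proof (induction n arbitrary: c)
  case (Suc n)
  have "(\<Sum>w\<in>words A (Suc n). \<Prod>i<Suc n. \<kappa> (w ! i) (c i))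
      = (\<Sum>a\<in>A. \<kappa> a (c 0)) * (\<Sum>v\<in>words A n. \<Prod>i<n. \<kappa> (v ! i) (c (Suc i)))"
    by (simp add: sum_words_Suc prod.lessThan_Suc_shift sum_product del: prod.lessThan_Suc)
  also have "\<dots> \<le> 1 * 1"
    using assms Suc.IH[of "\<lambda>i. c (Suc i)"] by (intro mult_mono sum_nonneg prod_nonneg) auto
  finally show ?case by simp
qed simp

subsection \<open>Gibbs' inequality and subadditive sequences\<close>

text \<open>Termwise this is \<open>ln t \<le> t - 1\<close> at \<open>t = q i / p i\<close>. The
  mass of \<open>q\<close> is only bounded above, so that sub-probabilities may serve as
  codes.\<close>

lemma gibbs_inequality:
  fixes p q :: "'i \<Rightarrow> real"
  assumes "\<And>i. i \<in> I \<Longrightarrow> p i \<ge> 0" "\<And>i. i \<in> I \<Longrightarrow> q i \<ge> 0"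
    and "\<And>i. i \<in> I \<Longrightarrow> p i > 0 \<Longrightarrow> q i > 0"
    and "(\<Sum>i\<in>I. q i) \<le> (\<Sum>i\<in>I. p i)"
  shows "- (\<Sum>i\<in>I. p i * ln (p i)) \<le> - (\<Sum>i\<in>I. p i * ln (q i))"
proof -
  have "p i * ln (q i) - p i * ln (p i) \<le> q i - p i" if i: "i \<in> I" for i
  proof (cases "p i = 0")
    case False
    then have pos: "p i > 0" "q i > 0" using assms i by (auto simp: order_less_le)
    then have "p i * ln (q i / p i) \<le> p i * (q i / p i - 1)"
      by (intro mult_left_mono ln_le_minus_one) auto
    moreover have "p i * (q i / p i - 1) = q i - p i" using pos by (simp add: field_simps)
    ultimately show ?thesis using pos by (simp add: ln_div right_diff_distrib)
  qed (use assms(2) i in simp)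
  then have "(\<Sum>i\<in>I. p i * ln (q i) - p i * ln (p i)) \<le> (\<Sum>i\<in>I. q i - p i)"
    by (rule sum_mono)
  then show ?thesis using assms(4) by (simp add: sum_subtractf)
qed

text \<open>Fekete's lemma: division with remainder by a nearly optimal \<open>k\<close> shows that
  the quotients tend to their infimum. Convergence matters because
  \<open>entropy_of_partition\<close> is defined by \<open>lim\<close>, which is informative only
  for convergent sequences.\<close>

lemma subadditive_convergent:
  fixes a :: "nat \<Rightarrow> real"
  assumes nonneg: "\<And>n. a n \<ge> 0" and sub: "\<And>m n. a (m + n) \<le> a m + a n"
  shows "convergent (\<lambda>n. a n / real n)"
proof -
  define L where "L = (INF n\<in>{0<..}. a n / real n)"
  have bdd: "bdd_below ((\<lambda>n. a n / real n) ` {0<..})"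
    using nonneg by (intro bdd_belowI[of _ 0]) auto
  have mult: "a (q * k + r) \<le> real q * a k + a r" for q k r
  proof (induction q)
    case (Suc q)
    have "a (Suc q * k + r) \<le> a k + a (q * k + r)"
      using sub[of k "q * k + r"] by (simp add: add.assoc)
    with Suc show ?case by (simp add: algebra_simps)
  qed simp
  have "(\<lambda>n. a n / real n) \<longlonglongrightarrow> L"
  proof (rule LIMSEQ_I)
    fix e :: real assume e: "e > 0"
    have "\<exists>k\<in>{0<..}. a k / real k < L + e / 2"
      using bdd e unfolding L_def by (subst cINF_less_iff[symmetric]) auto
    then obtain k where k: "k > 0" "a k / real k < L + e / 2" by auto
    \<comment> \<open>As \<open>a\<close> is nonnegative, this sum bounds \<open>a r\<close> for
      every remainder \<open>r < k\<close> at once.\<close>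
    define C where "C = (\<Sum>r<k. a r)"
    have C0: "C \<ge> 0" unfolding C_def using nonneg by (intro sum_nonneg) auto
    obtain N where N: "real N > 2 * C / e" using reals_Archimedean2 by blast
    have "norm (a n / real n - L) < e" if n: "n \<ge> max 1 N" for n
    proof -
      have n0: "real n > 0" using n by auto
      have "C / real n < e / 2" using n0 N n e by (simp add: field_simps)
         (smt (verit) mult_left_mono of_nat_le_iff)
      have "a n \<le> real (n div k) * a k + a (n mod k)"
        using mult[of "n div k" k "n mod k"] by simp
      also have "a (n mod k) \<le> C"
        unfolding C_def using k nonneg by (intro member_le_sum) auto
      also have "real (n div k) * a k \<le> real n / real k * a k"
        using nonneg by (intro mult_right_mono of_nat_div_le_of_nat) auto
      finally have "a n / real n \<le> (real n / real k * a k + C) / real n"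
        using n0 by (intro divide_right_mono) auto
      also have "\<dots> = a k / real k + C / real n" using n0 by (simp add: field_simps)
      also have "\<dots> < L + e" using k \<open>C / real n < e / 2\<close> by linarith
      finally have "a n / real n < L + e" .
      moreover have "L \<le> a n / real n"
        unfolding L_def using bdd n0 by (intro cINF_lower) auto
      ultimately show ?thesis using e by auto
    qed
    then show "\<exists>N. \<forall>n\<ge>N. norm (a n / real n - L) < e" by blast
  qed
  then show ?thesis by (rule convergentI)
qed

subsection \<open>Weights of words built from initial blocks\<close>

text \<open>
  The argument is the word read backwards, because shadowing provides blocks of \<open>S\<close> that end at a
  given position. Unfolding the recursion gives a sum over all ways to cut the word into single
  letters and initial blocks; a block in \<open>initial_words S k\<close> has length \<open>k + 1\<close>.
\<close>

fun block_weight :: "(nat \<Rightarrow> 'a) set \<Rightarrow> real \<Rightarrow> real \<Rightarrow> nat \<Rightarrow> 'a list \<Rightarrow> real" where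
  "block_weight S \<gamma> g L [] = 1"
| "block_weight S \<gamma> g L (x # xs) = \<gamma> * block_weight S \<gamma> g L xs +
     (\<Sum>k\<in>{L..length xs}. if rev (x # take k xs) \<in> initial_words S k
        then exp (- g * real k) * block_weight S \<gamma> g L (drop k xs) else 0)"

lemma block_weight_pos:
  assumes "\<gamma> > 0"
  shows "block_weight S \<gamma> g L xs > 0"
proof (induction xs rule: length_induct)
  case (1 xs)
  show ?case
  proof (cases xs)
    case (Cons y ys)
    have "block_weight S \<gamma> g L (drop k ys) > 0" for k
      using 1 Cons by simp
    then have "(\<Sum>k\<in>{L..length ys}. if rev (y # take k ys) \<in> initial_words S k
        then exp (- g * real k) * block_weight S \<gamma> g L (drop k ys) else 0) \<ge> 0"
      by (intro sum_nonneg) (auto intro: less_imp_le)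
    moreover have "\<gamma> * block_weight S \<gamma> g L ys > 0" using 1 Cons assms by simp
    ultimately show ?thesis by (simp add: Cons)
  qed simp
qed

lemma initial_words_length: "w \<in> initial_words S k \<Longrightarrow> length w = Suc k"
  by (auto simp: initial_words_def)

lemma finite_initial_words: "finite (initial_words (S :: (nat \<Rightarrow> 'a::finite) set) k)"
  by (rule finite_subset[OF _ finite_words[of UNIV "Suc k"]])
     (auto simp: words_def initial_words_length)

text \<open>Induction on the length, splitting off the first piece of the reversed word. Single
  letters contribute at most 1/2 by the bound on \<open>\<gamma>\<close>. A block leaves a shorter
  word, of total weight at most 1, so blocks contribute at most the sum in
  \<open>small\<close>.\<close>

lemma sum_block_weight_le_1:
  fixes S :: "(nat \<Rightarrow> 'a::finite) set"
  assumes \<gamma>: "\<gamma> \<ge> 0" "\<gamma> * real CARD('a) \<le> 1 / 2"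
    and small: "\<And>n. (\<Sum>k\<in>{L..n}. real (card (initial_words S k)) * exp (- g * real k)) \<le> 1 / 2"
  shows "(\<Sum>w\<in>words UNIV n. block_weight S \<gamma> g L w) \<le> 1"
proof (induction n rule: less_induct)
  case (less n)
  let ?W = "block_weight S \<gamma> g L" and ?U = "words (UNIV :: 'a set)"
  show ?case
  proof (cases n)
    case (Suc m)
    \<comment> \<open>For fixed \<open>k\<close>, a word is a leading piece of length
      \<open>k + 1\<close>, which must be a reversed block, followed by a free remainder; the double
      sum therefore factors.\<close>
    have block: "(\<Sum>a\<in>UNIV. \<Sum>v\<in>?U m. if rev (a # take k v) \<in> initial_words S k
          then exp (- g * real k) * ?W (drop k v) else 0)
        \<le> real (card (initial_words S k)) * exp (- g * real k)" if k: "k \<in> {L..m}" for k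
    proof -
      have "(\<Sum>a\<in>UNIV. \<Sum>v\<in>?U m. if rev (a # take k v) \<in> initial_words S k
          then exp (- g * real k) * ?W (drop k v) else 0)
        = (\<Sum>w\<in>?U (Suc k + (m - k)). if rev (take (Suc k) w) \<in> initial_words S k
          then exp (- g * real k) * ?W (drop (Suc k) w) else 0)"
        using k by (simp add: sum_words_Suc cong: if_cong)
      also have "\<dots> = (\<Sum>u\<in>?U (Suc k). (if rev u \<in> initial_words S k then 1 else 0)
          * (exp (- g * real k) * (\<Sum>v\<in>?U (m - k). ?W v)))"
        unfolding sum_words_add
        by (intro sum.cong refl) (auto simp: words_def sum_distrib_left intro!: sum.cong)
      also have "\<dots> \<le> (\<Sum>u\<in>?U (Suc k). (if rev u \<in> initial_words S k then 1 else 0)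
          * (exp (- g * real k) * 1))"
        using less.IH[of "m - k"] Suc by (intro sum_mono mult_left_mono) auto
      also have "\<dots> = exp (- g * real k) * real (card {u \<in> ?U (Suc k). rev u \<in> initial_words S k})"
        by (simp add: sum_distrib_left[symmetric] sum_distrib_right[symmetric] finite_words
            sum.If_cases Int_def)
      also have "card {u \<in> ?U (Suc k). rev u \<in> initial_words S k}
          = card (rev ` {u \<in> ?U (Suc k). rev u \<in> initial_words S k})"
        by (simp add: card_image)
      also have "\<dots> \<le> card (initial_words S k)"
        by (intro card_mono finite_initial_words) auto
      finally show ?thesis by (simp add: mult.commute)
    qed
    have "(\<Sum>w\<in>?U n. ?W w) = (\<Sum>a\<in>UNIV. \<Sum>v\<in>?U m. \<gamma> * ?W v +
        (\<Sum>k\<in>{L..m}. if rev (a # take k v) \<in> initial_words S k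
          then exp (- g * real k) * ?W (drop k v) else 0))"
      unfolding Suc sum_words_Suc by (intro sum.cong refl) (simp add: words_def)
    also have "\<dots> = (\<gamma> * real CARD('a)) * (\<Sum>v\<in>?U m. ?W v) +
        (\<Sum>a\<in>UNIV. \<Sum>v\<in>?U m. \<Sum>k\<in>{L..m}. if rev (a # take k v) \<in> initial_words S k
          then exp (- g * real k) * ?W (drop k v) else 0)"
      by (simp add: sum.distrib sum_distrib_left mult_ac)
    also have "(\<Sum>a\<in>UNIV. \<Sum>v\<in>?U m. \<Sum>k\<in>{L..m}. if rev (a # take k v) \<in> initial_words S k
          then exp (- g * real k) * ?W (drop k v) else 0)
        = (\<Sum>k\<in>{L..m}. \<Sum>a\<in>UNIV. \<Sum>v\<in>?U m. if rev (a # take k v) \<in> initial_words S k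
          then exp (- g * real k) * ?W (drop k v) else 0)"
      by (rule trans[OF sum.cong[OF refl sum.swap] sum.swap])
    also have "\<dots> \<le> (\<Sum>k\<in>{L..m}. real (card (initial_words S k)) * exp (- g * real k))"
      by (rule sum_mono[OF block])
    also have "\<dots> \<le> 1 / 2" by (rule small)
    also have "(\<gamma> * real CARD('a)) * (\<Sum>v\<in>?U m. ?W v) \<le> (\<gamma> * real CARD('a)) * 1"
      using less.IH[of m] Suc \<gamma> by (intro mult_left_mono) auto
    finally show ?thesis using \<gamma>(2) by simp
  qed simp
qed

text \<open>All terms of the recursion are nonnegative, so a single parsing bounds the weight from
  below. Parse greedily from the right end: remove a block wherever one ends, and a single letter at
  positions in \<open>Bad\<close>. Counting also the bad positions swallowed by blocks only weakens
  the bound, as \<open>\<gamma> \<le> 1\<close>.\<close>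

lemma block_weight_lower_bound:
  fixes x :: "nat \<Rightarrow> 'a" and S :: "(nat \<Rightarrow> 'a) set" and L R :: nat
  assumes \<gamma>: "0 < \<gamma>" "\<gamma> \<le> 1" and g: "g \<ge> 0"
  defines "Bad \<equiv> {j. \<not> (\<exists>k\<in>{L..R}. k \<le> j \<and> map (\<lambda>i. x (j - k + i)) [0..<Suc k] \<in> initial_words S k)}"
  shows "exp (- g * real N) * \<gamma> ^ card (Bad \<inter> {..<N})
    \<le> block_weight S \<gamma> g L (rev (map x [0..<N]))"
proof (induction N rule: less_induct)
  case (less N)
  let ?W = "block_weight S \<gamma> g L"
  have nonneg: "?W xs \<ge> 0" for xs
    using block_weight_pos[OF \<gamma>(1)] by (rule less_imp_le)
  show ?case
  proof (cases N)
    case (Suc n)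
    let ?ys = "rev (map x [0..<n])"
    let ?t = "\<lambda>k. if rev (x n # take k ?ys) \<in> initial_words S k
        then exp (- g * real k) * ?W (drop k ?ys) else 0"
    have W: "?W (rev (map x [0..<N])) = \<gamma> * ?W ?ys + (\<Sum>k\<in>{L..n}. ?t k)"
      by (simp add: Suc)
    have t_nonneg: "?t k \<ge> 0" for k using nonneg by simp
    show ?thesis
    proof (cases "n \<in> Bad")
      case True
      then have "card (Bad \<inter> {..<N}) = Suc (card (Bad \<inter> {..<n}))"
        by (simp add: Suc lessThan_Suc)
      then have "exp (- g * real N) * \<gamma> ^ card (Bad \<inter> {..<N})
          = \<gamma> * (exp (- g * real N) * \<gamma> ^ card (Bad \<inter> {..<n}))"
        by simp
      also have "\<dots> \<le> \<gamma> * (exp (- g * real n) * \<gamma> ^ card (Bad \<inter> {..<n}))"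
        using \<gamma> g by (intro mult_left_mono mult_right_mono) (auto simp: Suc algebra_simps)
      also have "\<dots> \<le> \<gamma> * ?W ?ys"
        using less.IH[of n] \<gamma> Suc by (intro mult_left_mono) auto
      also have "\<dots> \<le> ?W (rev (map x [0..<N]))"
        unfolding W using t_nonneg by (simp add: sum_nonneg)
      finally show ?thesis .
    next
      case False
      then obtain k where k: "k \<in> {L..R}" "k \<le> n"
          "map (\<lambda>i. x (n - k + i)) [0..<Suc k] \<in> initial_words S k"
        unfolding Bad_def by auto
      have drop: "drop k ?ys = rev (map x [0..<n - k])"
        by (simp add: drop_rev take_map)
      have "rev (x n # take k ?ys) = map x [n - k..<n] @ [x n]"
        using k(2) by (simp add: take_rev drop_map)
      also have "\<dots> = map (\<lambda>i. x (n - k + i)) [0..<Suc k]"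
        using k(2) by (intro nth_equalityI) (auto simp: nth_append)
      finally have t: "?t k = exp (- g * real k) * ?W (rev (map x [0..<n - k]))"
        using k(3) drop by simp
      \<comment> \<open>The block has \<open>k + 1\<close> letters but is charged only
        \<open>exp (- g * real k)\<close>. Since \<open>N = n + 1\<close>, the surplus factor
        \<open>exp (- g) \<le> 1\<close> is dropped here, together with the bad positions inside the
        block.\<close>
      have "exp (- g * real N) * \<gamma> ^ card (Bad \<inter> {..<N})
          \<le> exp (- g * real n) * \<gamma> ^ card (Bad \<inter> {..<n - k})"
        using \<gamma> g Suc by (intro mult_mono power_decreasing card_mono) (auto simp: algebra_simps)
      also have "\<dots> = exp (- g * real k) * (exp (- g * real (n - k)) * \<gamma> ^ card (Bad \<inter> {..<n - k}))"
        using k(2) by (simp add: mult.assoc[symmetric] exp_add[symmetric] of_nat_diff algebra_simps)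
      also have "\<dots> \<le> exp (- g * real k) * ?W (rev (map x [0..<n - k]))"
        using less.IH[of "n - k"] Suc by (intro mult_left_mono) auto
      also have "\<dots> = ?t k" using t by simp
      also have "\<dots> \<le> (\<Sum>k\<in>{L..n}. ?t k)"
        using k t_nonneg by (intro member_le_sum) auto
      also have "\<dots> \<le> ?W (rev (map x [0..<N]))"
        unfolding W using \<gamma> nonneg by simp
      finally show ?thesis .
    qed
  qed simp
qed

subsection \<open>Itineraries and entropy\<close>

locale invariant_partition = prob_space M for M :: "'b measure" +
  fixes T :: "'b \<Rightarrow> 'b" and P :: "'b set set"
  assumes invariant: "invariant_measure T M" and partition: "finite_measurable_partition M P"
begin

lemma finite_P: "finite P" and P_sets: "B \<in> P \<Longrightarrow> B \<in> sets M"
  and P_part: "partition_on (space M) P"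
  using partition by (auto simp: finite_measurable_partition_def)

definition atom :: "'b \<Rightarrow> 'b set" where
  "atom x = (THE B. B \<in> P \<and> x \<in> B)"

definition itinerary :: "nat \<Rightarrow> 'b \<Rightarrow> 'b set list" where
  "itinerary n x = map (\<lambda>i. atom ((T ^^ i) x)) [0..<n]"

definition itinerary_set :: "nat \<Rightarrow> 'b set list \<Rightarrow> 'b set" where
  "itinerary_set n w = {x \<in> space M. itinerary n x = w}"

text \<open>Shannon entropy of the law of the itinerary. Summing over all words, realised or not,
  lets the sums split along concatenation; empty sets contribute 0.\<close>

definition block_entropy :: "nat \<Rightarrow> real" where
  "block_entropy n =
     - (\<Sum>w\<in>words P n. prob (itinerary_set n w) * ln (prob (itinerary_set n w)))"

lemma atom_eq: "B \<in> P \<Longrightarrow> x \<in> B \<Longrightarrow> atom x = B"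
  unfolding atom_def using P_part
  by (intro the_equality) (auto simp: partition_on_def disjoint_def)

lemma atom_in: "x \<in> space M \<Longrightarrow> atom x \<in> P" and in_atom: "x \<in> space M \<Longrightarrow> x \<in> atom x"
proof -
  assume "x \<in> space M"
  then obtain B where "B \<in> P" "x \<in> B"
    using P_part by (auto simp: partition_on_def)
  then show "atom x \<in> P" "x \<in> atom x" using atom_eq by auto
qed

lemma atom_measurable: "atom \<in> measurable M (count_space P)"
proof -
  have "atom -` {B} \<inter> space M = B" if "B \<in> P" for B
    using that atom_eq in_atom sets.sets_into_space[OF P_sets[OF that]] by auto
  then show ?thesis
    using finite_P P_sets by (subst measurable_count_space_eq2) (auto simp: atom_in)
qed

lemma T_measurable: "T \<in> measurable M M"
  using invariant by (simp add: invariant_measure_def)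

lemma iterate_measurable: "T ^^ n \<in> measurable M M"
proof (induction n)
  case (Suc n)
  then show ?case using measurable_comp[OF Suc T_measurable] by (simp add: comp_def)
qed (simp add: id_def)

lemma iterate_space: "x \<in> space M \<Longrightarrow> (T ^^ n) x \<in> space M"
  using measurable_space[OF iterate_measurable] .

lemma prob_iterate_vimage:
  assumes "B \<in> sets M"
  shows "prob ((T ^^ n) -` B \<inter> space M) = prob B"
proof (induction n)
  case 0
  then show ?case using sets.sets_into_space[OF assms] by (simp add: Int_absorb2)
next
  case (Suc n)
  have "(T ^^ Suc n) -` B \<inter> space M = T -` ((T ^^ n) -` B \<inter> space M) \<inter> space M"
    using measurable_space[OF T_measurable]
    by (auto simp: funpow_Suc_right simp del: funpow.simps)
  also have "prob \<dots> = prob ((T ^^ n) -` B \<inter> space M)"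
    unfolding measure_def using invariant measurable_sets[OF iterate_measurable assms]
    by (intro arg_cong[where f = enn2real]) (auto simp only: invariant_measure_def)
  finally show ?case using Suc by (simp add: comp_def)
qed

lemma itinerary_in_words: "x \<in> space M \<Longrightarrow> itinerary n x \<in> words P n"
  by (auto simp: itinerary_def words_def intro: atom_in iterate_space)

lemma itinerary_add: "itinerary (m + n) x = itinerary m x @ itinerary n ((T ^^ m) x)"
  by (intro nth_equalityI) (auto simp: itinerary_def nth_append funpow_add[symmetric] comp_def
      simp flip: funpow_add[THEN fun_cong, unfolded comp_def] simp del: upt_Suc)

lemma itinerary_set_measurable:
  assumes "w \<in> words P n"
  shows "itinerary_set n w \<in> sets M"
proof -
  have "itinerary_set n w = {x \<in> space M. \<forall>i\<in>{..<n}. (atom \<circ> T ^^ i) x = w ! i}"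
    using assms by (auto simp: itinerary_set_def itinerary_def words_def list_eq_iff_nth_eq)
  also have "\<dots> \<in> sets M"
  proof (intro sets.sets_Collect_finite_All)
    fix i assume "i \<in> {..<n}"
    then have "w ! i \<in> P" using assms by (auto simp: words_def)
    then have "(atom \<circ> T ^^ i) -` {w ! i} \<inter> space M \<in> sets M"
      by (intro measurable_sets[OF measurable_comp[OF iterate_measurable atom_measurable]]) auto
    then show "{x \<in> space M. (atom \<circ> T ^^ i) x = w ! i} \<in> sets M"
      by (simp add: vimage_def Int_def conj_commute)
  qed auto
  finally show ?thesis .
qed

text \<open>The integrand takes finitely many values, and invariance removes the shift by
  \<open>m\<close>. The shift describes the tail of a longer itinerary, and later leaves room for
  coordinates to the left of time \<open>m\<close>.\<close>

lemma integral_itinerary: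
  fixes F :: "'b set list \<Rightarrow> real"
  shows "integrable M (\<lambda>x. F (itinerary n ((T ^^ m) x)))"
    and "(\<integral>x. F (itinerary n ((T ^^ m) x)) \<partial>M)
      = (\<Sum>w\<in>words P n. F w * prob (itinerary_set n w))"
proof -
  let ?B = "\<lambda>w. (T ^^ m) -` itinerary_set n w \<inter> space M"
  let ?G = "\<lambda>x. \<Sum>w\<in>words P n. F w * indicator (?B w) x :: real"
  have B: "?B w \<in> sets M" if "w \<in> words P n" for w
    by (rule measurable_sets[OF iterate_measurable itinerary_set_measurable[OF that]])
  have eq: "F (itinerary n ((T ^^ m) x)) = ?G x" if x: "x \<in> space M" for x
  proof -
    have "?G x = (\<Sum>w\<in>words P n. if w = itinerary n ((T ^^ m) x) then F w else 0)"
      using x by (intro sum.cong) (auto simp: itinerary_set_def iterate_space)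
    then show ?thesis
      using x by (simp add: finite_words finite_P itinerary_in_words iterate_space)
  qed
  have int: "integrable M (\<lambda>x. F w * indicator (?B w) x)" if "w \<in> words P n" for w
    using B[OF that] by (auto intro!: integrable_mult_right integrable_real_indicator simp: emeasure_eq_measure)
  then have "integrable M ?G" by (intro Bochner_Integration.integrable_sum) auto
  then show "integrable M (\<lambda>x. F (itinerary n ((T ^^ m) x)))"
    by (subst Bochner_Integration.integrable_cong[OF refl eq]) auto
  have "(\<integral>x. F (itinerary n ((T ^^ m) x)) \<partial>M) = (\<integral>x. ?G x \<partial>M)"
    by (intro Bochner_Integration.integral_cong refl eq)
  also have "\<dots> = (\<Sum>w\<in>words P n. F w * prob (?B w))"
    using B by (subst Bochner_Integration.integral_sum[OF int]) (auto intro!: sum.cong simp: Int_absorb2)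
  also have "\<dots> = (\<Sum>w\<in>words P n. F w * prob (itinerary_set n w))"
    by (intro sum.cong refl arg_cong2[where f = times] prob_iterate_vimage itinerary_set_measurable)
  finally show "(\<integral>x. F (itinerary n ((T ^^ m) x)) \<partial>M)
      = (\<Sum>w\<in>words P n. F w * prob (itinerary_set n w))" .
qed

lemma sum_prob_itinerary_set: "(\<Sum>w\<in>words P n. prob (itinerary_set n w)) = 1"
  using integral_itinerary(2)[of "\<lambda>_. 1" n 0] by (simp add: prob_space)

section \<open>Entropy of finite itineraries\<close>

lemma block_entropy_nonneg: "block_entropy n \<ge> 0"
proof -
  have "p * ln p \<le> 0" if "0 \<le> p" "p \<le> 1" for p :: real
    using that by (cases "p = 0") (auto intro!: mult_nonneg_nonpos)
  then show ?thesis
    unfolding block_entropy_def by (simp add: sum_nonpos)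
qed

text \<open>Gibbs' inequality against the product of the laws of the first \<open>m\<close> and the
  last \<open>n\<close> symbols. By invariance the last \<open>n\<close> symbols have the law of an
  itinerary of length \<open>n\<close>, so the cross entropy is the sum of the two block
  entropies.\<close>

lemma block_entropy_subadditive: "block_entropy (m + n) \<le> block_entropy m + block_entropy n"
proof -
  let ?\<nu> = "\<lambda>k w. prob (itinerary_set k w)"
  let ?q = "\<lambda>w. ?\<nu> m (take m w) * ?\<nu> n (drop m w)"
  have td: "take m w \<in> words P m" "drop m w \<in> words P n" if "w \<in> words P (m + n)" for w
    using that by (auto simp: words_def dest: in_set_takeD in_set_dropD)
  have it: "itinerary m x = take m w" "itinerary n ((T ^^ m) x) = drop m w"
    if "itinerary (m + n) x = w" for x w
    using that[symmetric] by (auto simp: itinerary_add) (auto simp: itinerary_def)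
  \<comment> \<open>Both Gibbs' inequality and the splitting of the logarithm of the product rely on
    this positivity.\<close>
  have pos: "?\<nu> m (take m w) > 0 \<and> ?\<nu> n (drop m w) > 0"
    if w: "w \<in> words P (m + n)" and p: "?\<nu> (m + n) w > 0" for w
  proof -
    have "?\<nu> (m + n) w \<le> ?\<nu> m (take m w)"
      using it by (intro finite_measure_mono itinerary_set_measurable td[OF w])
        (auto simp: itinerary_set_def)
    moreover have "?\<nu> (m + n) w \<le> prob ((T ^^ m) -` itinerary_set n (drop m w) \<inter> space M)"
      using it by (intro finite_measure_mono measurable_sets[OF iterate_measurable]
          itinerary_set_measurable td[OF w]) (auto simp: itinerary_set_def iterate_space)
    ultimately show ?thesis
      using p prob_iterate_vimage[OF itinerary_set_measurable[OF td(2)[OF w]], of m] by linarith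
  qed
  have "(\<Sum>w\<in>words P (m + n). ?q w) = (\<Sum>u\<in>words P m. ?\<nu> m u) * (\<Sum>v\<in>words P n. ?\<nu> n v)"
    unfolding sum_words_add sum_product by (intro sum.cong refl) (auto simp: words_def)
  then have "block_entropy (m + n) \<le> - (\<Sum>w\<in>words P (m + n). ?\<nu> (m + n) w * ln (?q w))"
    unfolding block_entropy_def
    by (intro gibbs_inequality) (auto simp: sum_prob_itinerary_set pos)
  also have "(\<Sum>w\<in>words P (m + n). ?\<nu> (m + n) w * ln (?q w))
      = (\<Sum>w\<in>words P (m + n). ln (?\<nu> m (take m w)) * ?\<nu> (m + n) w)
        + (\<Sum>w\<in>words P (m + n). ln (?\<nu> n (drop m w)) * ?\<nu> (m + n) w)"
    unfolding sum.distrib[symmetric]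
  proof (intro sum.cong refl)
    fix w assume w: "w \<in> words P (m + n)"
    show "?\<nu> (m + n) w * ln (?q w)
        = ln (?\<nu> m (take m w)) * ?\<nu> (m + n) w + ln (?\<nu> n (drop m w)) * ?\<nu> (m + n) w"
      using pos[OF w] measure_nonneg[of M "itinerary_set (m + n) w"]
      by (cases "?\<nu> (m + n) w = 0") (auto simp: ln_mult algebra_simps order_less_le)
  qed
  also have "(\<Sum>w\<in>words P (m + n). ln (?\<nu> m (take m w)) * ?\<nu> (m + n) w)
      = (\<integral>x. ln (?\<nu> m (take m (itinerary (m + n) ((T ^^ 0) x)))) \<partial>M)"
    by (rule integral_itinerary(2)[symmetric])
  also have "\<dots> = (\<integral>x. ln (?\<nu> m (itinerary m ((T ^^ 0) x))) \<partial>M)"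
    by (simp add: it(1)[OF refl, symmetric])
  also have "\<dots> = - block_entropy m"
    by (subst integral_itinerary(2)) (simp add: block_entropy_def mult.commute)
  also have "(\<Sum>w\<in>words P (m + n). ln (?\<nu> n (drop m w)) * ?\<nu> (m + n) w)
      = (\<integral>x. ln (?\<nu> n (drop m (itinerary (m + n) ((T ^^ 0) x)))) \<partial>M)"
    by (rule integral_itinerary(2)[symmetric])
  also have "\<dots> = (\<integral>x. ln (?\<nu> n (itinerary n ((T ^^ m) x))) \<partial>M)"
    by (simp add: it(2)[OF refl, symmetric])
  also have "\<dots> = - block_entropy n"
    by (subst integral_itinerary(2)) (simp add: block_entropy_def mult.commute)
  finally show ?thesis by simp
qed

text \<open>\<open>- ln q\<close> acts as a code length, and Gibbs' inequality bounds the entropy by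
  the expected length. The pointwise majorant \<open>U\<close> allows a function whose integral is
  easy to compute.\<close>

lemma block_entropy_le_integral:
  assumes pos: "\<And>w. w \<in> words P n \<Longrightarrow> q w > 0" and sum: "(\<Sum>w\<in>words P n. q w) \<le> 1"
    and U: "integrable M U" "\<And>x. x \<in> space M \<Longrightarrow> - ln (q (itinerary n ((T ^^ m) x))) \<le> U x"
  shows "block_entropy n \<le> (\<integral>x. U x \<partial>M)"
proof -
  have "block_entropy n \<le> - (\<Sum>w\<in>words P n. prob (itinerary_set n w) * ln (q w))"
    unfolding block_entropy_def using pos sum
    by (intro gibbs_inequality) (auto simp: sum_prob_itinerary_set intro: less_imp_le)
  also have "\<dots> = (\<Sum>w\<in>words P n. - ln (q w) * prob (itinerary_set n w))"
    by (simp add: sum_negf mult.commute)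
  also have "\<dots> = (\<integral>x. - ln (q (itinerary n ((T ^^ m) x))) \<partial>M)"
    by (rule integral_itinerary(2)[symmetric])
  also have "\<dots> \<le> (\<integral>x. U x \<partial>M)"
    by (intro integral_mono integral_itinerary(1) U)
  finally show ?thesis .
qed

section \<open>Itineraries and the cells of iterated joins\<close>

text \<open>A nonempty cell is determined by any of its points \<open>x\<close>: each member chosen
  for it must contain \<open>x\<close>, hence consists of the points with the same symbol as
  \<open>x\<close> at that time.\<close>

lemma iterated_partition_eq:
  assumes "n > 0"
  shows "iterated_partition M T P n = itinerary_set n ` words P n - {{}}"
proof -
  define Q where "Q i = pullback_partition M (T ^^ i) P" for i
  have Q: "{y \<in> space M. atom ((T ^^ i) y) = atom ((T ^^ i) x)} \<in> Q i" if "x \<in> space M" for i x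
  proof -
    have "{y \<in> space M. atom ((T ^^ i) y) = atom ((T ^^ i) x)}
        = (T ^^ i) -` atom ((T ^^ i) x) \<inter> space M"
      using that atom_eq[OF atom_in[OF iterate_space[OF that]]]
      by (auto simp: iterate_space) (metis in_atom iterate_space)
    moreover have "x \<in> {y \<in> space M. atom ((T ^^ i) y) = atom ((T ^^ i) x)}"
      using that by simp
    ultimately show ?thesis
      using that unfolding Q_def pullback_partition_def
      by (auto intro: atom_in iterate_space)
  qed
  have Q': "R = {y \<in> space M. atom ((T ^^ i) y) = atom ((T ^^ i) x)}"
    if "R \<in> Q i" "x \<in> R" for R i x
  proof -
    obtain B where B: "B \<in> P" "R = (T ^^ i) -` B \<inter> space M"
      using \<open>R \<in> Q i\<close> by (auto simp: Q_def pullback_partition_def)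
    then have "atom ((T ^^ i) x) = B" using \<open>x \<in> R\<close> by (intro atom_eq) auto
    moreover have "(T ^^ i) y \<in> B \<longleftrightarrow> atom ((T ^^ i) y) = B" if "y \<in> space M" for y
      using atom_eq[OF B(1), of "(T ^^ i) y"] in_atom[OF iterate_space[OF that, of i]] by auto
    ultimately show ?thesis using B(2) by auto
  qed
  \<comment> \<open>Here \<open>n > 0\<close> matters: the empty intersection would be the whole
    type and not \<open>space M\<close>.\<close>
  have level: "itinerary_set n (itinerary n x)
      = (\<Inter>i<n. {y \<in> space M. atom ((T ^^ i) y) = atom ((T ^^ i) x)})" for x
    using assms by (auto simp: itinerary_set_def itinerary_def)
  have eq: "iterated_partition M T P n = (\<lambda>x. itinerary_set n (itinerary n x)) ` space M"
  proof (intro set_eqI iffI)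
    fix X assume "X \<in> iterated_partition M T P n"
    then obtain f where f: "f \<in> (\<Pi> R\<in>Q ` {..<n}. R)" "X = \<Inter> (f ` Q ` {..<n})" "X \<noteq> {}"
      unfolding iterated_partition_def common_refinement Q_def[symmetric] by auto
    then obtain x where x: "x \<in> X" by auto
    have "f (Q i) = {y \<in> space M. atom ((T ^^ i) y) = atom ((T ^^ i) x)}" if "i < n" for i
      using that f x by (intro Q') auto
    then have "X = itinerary_set n (itinerary n x)" "x \<in> space M"
      using f(2) x assms by (auto simp: level)
    then show "X \<in> (\<lambda>x. itinerary_set n (itinerary n x)) ` space M" by auto
  next
    fix X assume "X \<in> (\<lambda>x. itinerary_set n (itinerary n x)) ` space M"
    then obtain x where x: "x \<in> space M" "X = itinerary_set n (itinerary n x)" by auto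
    \<comment> \<open>Choice functions act on partitions, not on times, so equal partitions at
      different times share one value. This is harmless: the member containing \<open>x\<close>
      depends on the partition alone.\<close>
    define f where "f = (\<lambda>R. THE B. B \<in> R \<and> x \<in> B)"
    have f: "f (Q i) = {y \<in> space M. atom ((T ^^ i) y) = atom ((T ^^ i) x)}" for i
      unfolding f_def
    proof (rule the_equality)
      show "{y \<in> space M. atom ((T ^^ i) y) = atom ((T ^^ i) x)} \<in> Q i
          \<and> x \<in> {y \<in> space M. atom ((T ^^ i) y) = atom ((T ^^ i) x)}"
        using Q[OF x(1)] x(1) by blast
    qed (use Q' in blast)
    have "X = \<Inter> (f ` Q ` {..<n})" using x(2) by (simp add: level f)
    moreover have "x \<in> X" using x by (simp add: itinerary_set_def)
    moreover have "f \<in> (\<Pi> R\<in>Q ` {..<n}. R)" using Q[OF x(1)] by (auto simp: f)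
    ultimately show "X \<in> iterated_partition M T P n"
      unfolding iterated_partition_def common_refinement Q_def[symmetric] by blast
  qed
  also have "\<dots> = itinerary_set n ` words P n - {{}}"
    by (auto simp: itinerary_set_def itinerary_in_words)
  finally show ?thesis .
qed

text \<open>Different words have disjoint itinerary sets, so these coincide only when empty, and
  then the terms vanish.\<close>

lemma partition_entropy_eq:
  assumes "n > 0"
  shows "partition_entropy M (iterated_partition M T P n) = block_entropy n"
proof -
  let ?h = "\<lambda>B. prob B * ln (prob B)"
  have "(\<Sum>B\<in>iterated_partition M T P n. ?h B) = (\<Sum>B\<in>itinerary_set n ` words P n. ?h B)"
    unfolding iterated_partition_eq[OF assms]
    by (intro sum.mono_neutral_left) (auto simp: finite_words finite_P)
  also have "\<dots> = (\<Sum>w\<in>words P n. (?h \<circ> itinerary_set n) w)"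
  proof (rule sum.reindex_nontrivial)
    fix v w assume "v \<noteq> w" "itinerary_set n v = itinerary_set n w"
    then have "itinerary_set n v = {}" by (auto simp: itinerary_set_def)
    then show "?h (itinerary_set n v) = 0" by simp
  qed (simp add: finite_words finite_P)
  finally show ?thesis by (simp add: partition_entropy_def block_entropy_def)
qed

lemma entropy_of_partition_le:
  assumes "\<And>n. block_entropy n \<le> c * real n + d"
  shows "entropy_of_partition M T P \<le> c"
proof -
  let ?a = "\<lambda>n. block_entropy n / real n"
  obtain l where l: "?a \<longlonglongrightarrow> l"
    using subadditive_convergent[OF block_entropy_nonneg block_entropy_subadditive]
    by (auto simp: convergent_def)
  have "eventually (\<lambda>n. ?a n = partition_entropy M (iterated_partition M T P n) / real n) sequentially"
    using eventually_gt_at_top[of 0] by eventually_elim (simp add: partition_entropy_eq)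
  then have "(\<lambda>n. partition_entropy M (iterated_partition M T P n) / real n) \<longlonglongrightarrow> l"
    using l by (rule Lim_transform_eventually[rotated])
  then have "entropy_of_partition M T P = l"
    unfolding entropy_of_partition_def by (rule limI)
  moreover have "l \<le> c"
  proof (rule LIMSEQ_le[OF l])
    have "(\<lambda>n. c + d * (1 / real n)) \<longlonglongrightarrow> c + d * 0"
      by (intro tendsto_intros lim_1_over_n)
    then show "(\<lambda>n. c + d * (1 / real n)) \<longlonglongrightarrow> c" by simp
    show "\<exists>N. \<forall>n\<ge>N. ?a n \<le> c + d * (1 / real n)"
      using assms by (intro exI[of _ 1]) (auto simp: field_simps)
  qed
  ultimately show ?thesis by simp
qed

end

subsection \<open>Approximation by sets depending on finitely many coordinates\<close>

lemma left_shift_iterate: "(left_shift ^^ j) (x :: int \<Rightarrow> 'a) = (\<lambda>i. x (i + int j))"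
  by (induction j) (auto simp: left_shift_def fun_eq_iff algebra_simps)

lemma topspace_sequence_topology: "topspace (sequence_topology :: ('i \<Rightarrow> 'a) topology) = UNIV"
  by (simp add: sequence_topology_def)

locale sequence_measure = prob_space M for M :: "(int \<Rightarrow> 'a::finite) measure" +
  fixes X :: "(int \<Rightarrow> 'a) set"
  assumes sets_borel: "sets M = sets (borel_sigma (subtopology sequence_topology X))"
begin

lemma sets_eq: "sets M = sigma_sets X {U. openin (subtopology sequence_topology X) U}"
proof -
  have "{U. openin (subtopology sequence_topology X) U} \<subseteq> Pow X"
    using openin_subset by (fastforce simp: topspace_sequence_topology)
  then show ?thesis
    by (simp add: sets_borel borel_sigma_def topspace_sequence_topology)
qed

lemma space_eq: "space M = X"
proof -
  have "space M = space (borel_sigma (subtopology sequence_topology X))"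
    by (rule sets_eq_imp_space_eq[OF sets_borel])
  then show ?thesis
    by (simp add: borel_sigma_def space_measure_of_conv topspace_sequence_topology)
qed

text \<open>Finite unions of cylinders, taken relative to \<open>X\<close> so that complements in
  \<open>X\<close> stay in the class.\<close>

definition window_set :: "nat \<Rightarrow> (int \<Rightarrow> 'a) set \<Rightarrow> bool" where
  "window_set m C \<longleftrightarrow> C \<subseteq> X \<and>
     (\<forall>x\<in>C. \<forall>y\<in>X. (\<forall>i\<in>{- int m..int m}. y i = x i) \<longrightarrow> y \<in> C)"

lemma coordinate_measurable: "{x \<in> X. x i = a} \<in> sets M"
proof -
  have "openin sequence_topology {x \<in> topspace sequence_topology. x i \<in> {a}}"
    unfolding sequence_topology_def
    by (rule openin_continuous_map_preimage[OF continuous_map_product_projection]) auto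
  then have "openin (subtopology sequence_topology X) {x \<in> X. x i = a}"
    unfolding openin_subtopology
    by (intro exI[of _ "{x. x i = a}"]) (auto simp: topspace_sequence_topology)
  then show ?thesis by (auto simp: sets_eq)
qed

lemma word_measurable: "(\<lambda>x. map x js) \<in> measurable M (count_space UNIV)"
proof -
  have "(\<lambda>x. map x js) -` {w} \<inter> X \<in> sets M" for w :: "'a list"
  proof (cases "length w = length js")
    case True
    then have "(\<lambda>x. map x js) -` {w} \<inter> X = {x \<in> space M. \<forall>i\<in>{..<length js}. x (js ! i) = w ! i}"
      by (auto simp: list_eq_iff_nth_eq space_eq)
    also have "\<dots> \<in> sets M"
      using coordinate_measurable by (intro sets.sets_Collect_finite_All) (auto simp: space_eq)
    finally show ?thesis .
  next
    case False
    then have "(\<lambda>x. map x js) -` {w} \<inter> X = {}" by auto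
    then show ?thesis by simp
  qed
  then show ?thesis by (simp add: measurable_count_space_eq2_countable space_eq)
qed

lemma window_set_measurable:
  assumes "window_set m C"
  shows "C \<in> sets M"
proof -
  have "C = (\<lambda>x. map x [- int m..int m]) -` ((\<lambda>x. map x [- int m..int m]) ` C) \<inter> space M"
    using assms by (auto simp: window_set_def space_eq)
  also have "\<dots> \<in> sets M" by (rule measurable_sets[OF word_measurable]) simp
  finally show ?thesis .
qed

lemma window_set_mono: "window_set m C \<Longrightarrow> m \<le> m' \<Longrightarrow> window_set m' C"
  unfolding window_set_def by (meson atLeastAtMost_iff le_imp_neg_le order_trans of_nat_mono)

lemma window_set_compl: "window_set m C \<Longrightarrow> window_set m (X - C)"
  unfolding window_set_def by auto

lemma window_set_UN: "(\<And>i. i \<in> I \<Longrightarrow> window_set m (C i)) \<Longrightarrow> window_set m (\<Union>i\<in>I. C i)"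
  unfolding window_set_def by blast

text \<open>Collect the points whose whole window cylinder lies in \<open>U\<close>. These sets
  increase to \<open>U\<close> as the window grows, because a basic open set restricts only finitely
  many coordinates; continuity of the measure concludes.\<close>

lemma open_approximation:
  assumes "openin (subtopology sequence_topology X) U" "e > 0"
  shows "\<exists>m C. window_set m C \<and> C \<subseteq> U \<and> measure M (U - C) < e"
proof -
  define C where "C m = {x \<in> X. \<forall>y\<in>X. (\<forall>i\<in>{- int m..int m}. y i = x i) \<longrightarrow> y \<in> U}" for m
  obtain V where V: "openin sequence_topology V" "U = V \<inter> X"
    using assms(1) by (auto simp: openin_subtopology)
  have C: "window_set m (C m)" for m
    unfolding window_set_def C_def by auto
  have mono: "C m \<subseteq> C m'" if "m \<le> m'" for m m'
    using that unfolding C_def by auto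
  have "U \<subseteq> (\<Union>m. C m)"
  proof
    fix x assume x: "x \<in> U"
    then obtain W where W: "finite {i. W i \<noteq> UNIV}" "x \<in> Pi\<^sub>E UNIV W" "Pi\<^sub>E UNIV W \<subseteq> V"
      using V unfolding sequence_topology_def openin_product_topology_alt by auto
    obtain m where m: "\<And>i. W i \<noteq> UNIV \<Longrightarrow> nat \<bar>i\<bar> \<le> m"
      using finite_imageI[OF W(1), of "\<lambda>i. nat \<bar>i\<bar>"]
      by (metis (mono_tags, lifting) finite_nat_set_iff_bounded_le imageI mem_Collect_eq)
    have "y \<in> U" if y: "y \<in> X" "\<forall>i\<in>{- int m..int m}. y i = x i" for y
    proof -
      have "y i \<in> W i" for i
      proof (cases "W i = UNIV")
        case False
        then have "i \<in> {- int m..int m}" using m[of i] by auto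
        then show ?thesis using y W(2) by (auto simp: PiE_iff)
      qed simp
      then show ?thesis using W(3) V y by auto
    qed
    then show "x \<in> (\<Union>m. C m)" using x V unfolding C_def by blast
  qed
  moreover have "C m \<subseteq> U" for m unfolding C_def by auto
  ultimately have U: "U = (\<Union>m. C m)" by blast
  have "(\<lambda>m. measure M (C m)) \<longlonglongrightarrow> measure M U"
    unfolding U using C window_set_measurable mono
    by (intro finite_Lim_measure_incseq) (auto simp: incseq_def)
  then obtain m where "norm (measure M (C m) - measure M U) < e"
    using LIMSEQ_D[OF _ \<open>e > 0\<close>] by blast
  moreover have "measure M (U - C m) = measure M U - measure M (C m)"
    using \<open>C m \<subseteq> U\<close> window_set_measurable[OF C] assms(1)
    by (intro finite_measure_Diff) (auto simp: sets_eq)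
  ultimately show ?thesis using C \<open>C m \<subseteq> U\<close> by (intro exI[of _ m] exI[of _ "C m"]) auto
qed

text \<open>The sets that can be approximated include the open sets and are closed under complements
  and countable unions. A countable union is first cut down to a finite one.\<close>

lemma window_approximation:
  assumes "B \<in> sets M" "e > 0"
  shows "\<exists>m C. window_set m C \<and> measure M (sym_diff B C) < e"
  using assms(1)[unfolded sets_eq] assms(2)
proof (induction B arbitrary: e rule: sigma_sets.induct)
  case (Basic U)
  then obtain m C where C: "window_set m C" "C \<subseteq> U" "measure M (U - C) < e"
    using open_approximation by blast
  then have "sym_diff U C = U - C" by auto
  with C show ?case by (intro exI[of _ m] exI[of _ C]) simp
next
  case Empty
  then show ?case
    by (intro exI[of _ 0] exI[of _ "{}"]) (simp add: window_set_def)
next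
  case (Compl A)
  then obtain m C where C: "window_set m C" "measure M (sym_diff A C) < e" by blast
  have "A \<subseteq> X" using sigma_sets_into_sp[OF _ Compl(1)] openin_subset
    by (fastforce simp: topspace_sequence_topology)
  moreover have "C \<subseteq> X" using C(1) by (simp add: window_set_def)
  ultimately have "sym_diff (X - A) (X - C) = sym_diff A C" by auto
  then show ?case using C window_set_compl by metis
next
  case (Union A)
  have A: "A i \<in> sets M" for i using Union(1) by (simp add: sets_eq)
  have "(\<lambda>k. measure M (\<Union>i\<le>k. A i)) \<longlonglongrightarrow> measure M (\<Union>k. \<Union>i\<le>k. A i)"
  proof (rule finite_Lim_measure_incseq)
    show "incseq (\<lambda>k. \<Union>i\<le>k. A i)" by (fastforce simp: incseq_def)
  qed (use A in auto)
  moreover have UA: "(\<Union>k. \<Union>i\<le>k. A i) = (\<Union>i. A i)" by auto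
  ultimately obtain k where "norm (measure M (\<Union>i\<le>k. A i) - measure M (\<Union>i. A i)) < e / 2"
    using LIMSEQ_D[of _ _ "e / 2"] Union(3) by (metis half_gt_zero order_refl)
  moreover have "measure M ((\<Union>i. A i) - (\<Union>i\<le>k. A i)) = measure M (\<Union>i. A i) - measure M (\<Union>i\<le>k. A i)"
    using A by (intro finite_measure_Diff) auto
  ultimately have tail: "measure M ((\<Union>i. A i) - (\<Union>i\<le>k. A i)) < e / 2"
    unfolding real_norm_def by linarith
  \<comment> \<open>Half of \<open>e\<close> pays for the tail of the union; the
    \<open>k + 1\<close> sets that are kept share the other half.\<close>
  have "\<exists>m C. window_set m C \<and> measure M (sym_diff (A i) C) < e / (2 * real (Suc k))" for i
    using Union(3) by (intro Union.IH) auto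
  then obtain m C where C: "\<And>i. window_set (m i) (C i)"
      "\<And>i. measure M (sym_diff (A i) (C i)) < e / (2 * real (Suc k))"
    by metis
  define m' where "m' = Max (m ` {..k})"
  have win: "window_set m' (\<Union>i\<in>{..k}. C i)"
    by (intro window_set_UN window_set_mono[OF C(1)]) (auto simp: m'_def)
  have D: "sym_diff (A i) (C i) \<in> sets M" for i
    using A window_set_measurable[OF C(1)] by auto
  have "measure M (sym_diff (\<Union>i. A i) (\<Union>i\<in>{..k}. C i))
      \<le> measure M (((\<Union>i. A i) - (\<Union>i\<le>k. A i)) \<union> (\<Union>i\<in>{..k}. sym_diff (A i) (C i)))"
    using A D by (intro finite_measure_mono) auto
  also have "\<dots> \<le> measure M ((\<Union>i. A i) - (\<Union>i\<le>k. A i)) + measure M (\<Union>i\<in>{..k}. sym_diff (A i) (C i))"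
    using A D by (intro measure_Un_le) auto
  also have "measure M (\<Union>i\<in>{..k}. sym_diff (A i) (C i)) \<le> (\<Sum>i\<in>{..k}. measure M (sym_diff (A i) (C i)))"
    using D by (intro finite_measure_subadditive_finite) auto
  also have "\<dots> \<le> (\<Sum>i\<in>{..k}. e / (2 * real (Suc k)))"
    using C(2) by (intro sum_mono less_imp_le)
  also have "\<dots> = e / 2" by (simp add: field_simps)
  finally have "measure M (sym_diff (\<Union>i. A i) (\<Union>i\<in>{..k}. C i)) < e" using tail by simp
  then show ?case using win by blast
qed

text \<open>Each cell is approximated by a window set, and \<open>D\<close> is the union of the
  symmetric differences. Outside \<open>D\<close> a point belongs to the approximation of its own
  cell and of no other, so its window names its cell.\<close>

lemma partition_approximation:
  assumes P: "finite_measurable_partition M P" and e: "e > 0"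
  obtains m f D where "D \<in> sets M" "measure M D < e"
    "\<And>x B. x \<in> X - D \<Longrightarrow> B \<in> P \<Longrightarrow> x \<in> B \<Longrightarrow> f (map x [- int m..int m]) = B"
proof -
  have fin: "finite P" and PM: "\<And>B. B \<in> P \<Longrightarrow> B \<in> sets M" and part: "partition_on X P"
    using P by (auto simp: finite_measurable_partition_def space_eq)
  have "\<exists>m C. window_set m C \<and> measure M (sym_diff B C) < e / (real (card P) + 1)" if "B \<in> P" for B
    using e that by (intro window_approximation PM) auto
  then obtain m C where C: "\<And>B. B \<in> P \<Longrightarrow> window_set (m B) (C B)"
      "\<And>B. B \<in> P \<Longrightarrow> measure M (sym_diff B (C B)) < e / (real (card P) + 1)"
    by metis
  define m' where "m' = Max (insert 0 (m ` P))"
  have win: "window_set m' (C B)" if "B \<in> P" for B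
    using that fin by (intro window_set_mono[OF C(1)]) (auto simp: m'_def)
  let ?w = "\<lambda>x :: int \<Rightarrow> 'a. map x [- int m'..int m']"
  define D where "D = (\<Union>B\<in>P. sym_diff B (C B))"
  define f where "f w = (SOME B. B \<in> P \<and> w \<in> ?w ` C B)" for w
  have Dm: "sym_diff B (C B) \<in> sets M" if "B \<in> P" for B
    using that PM window_set_measurable[OF C(1)] by auto
  have "measure M D \<le> (\<Sum>B\<in>P. measure M (sym_diff B (C B)))"
    unfolding D_def using fin Dm by (intro finite_measure_subadditive_finite) auto
  also have "\<dots> \<le> real (card P) * (e / (real (card P) + 1))"
    using C(2) by (intro sum_bounded_above) (auto intro: less_imp_le)
  also have "\<dots> < e" using e by (simp add: field_simps)
  finally have De: "measure M D < e" .
  have fB: "f (?w x) = B" if x: "x \<in> X - D" and B: "B \<in> P" "x \<in> B" for x B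
  proof -
    have iff: "?w x \<in> ?w ` C B' \<longleftrightarrow> x \<in> B'" if B': "B' \<in> P" for B'
    proof -
      have "?w x \<in> ?w ` C B' \<longleftrightarrow> x \<in> C B'"
      proof
        assume "?w x \<in> ?w ` C B'"
        then obtain y where y: "y \<in> C B'" "?w x = ?w y" by auto
        then have "\<forall>i\<in>{- int m'..int m'}. x i = y i" by simp
        then show "x \<in> C B'" using win[OF B'] x y(1) unfolding window_set_def by blast
      qed auto
      also have "\<dots> \<longleftrightarrow> x \<in> B'" using x B' by (auto simp: D_def)
      finally show ?thesis .
    qed
    have "\<exists>B. B \<in> P \<and> ?w x \<in> ?w ` C B" using iff B by blast
    from someI_ex[OF this] have "f (?w x) \<in> P \<and> ?w x \<in> ?w ` C (f (?w x))"
      unfolding f_def .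
    then have "f (?w x) \<in> P" "x \<in> f (?w x)" using iff by auto
    then show ?thesis using B part by (auto simp: partition_on_def disjoint_def)
  qed
  have "D \<in> sets M" unfolding D_def using fin Dm by auto
  then show ?thesis using De fB by (rule that)
qed

subsection \<open>Positions where shadowing blocks of bounded length end\<close>

definition good :: "(nat \<Rightarrow> 'a) set \<Rightarrow> nat \<Rightarrow> nat \<Rightarrow> (int \<Rightarrow> 'a) set" where
  "good S L R = {x \<in> X. \<exists>k\<in>{L..R}. map (\<lambda>i. x (int i - int k)) [0..<Suc k] \<in> initial_words S k}"

lemma good_measurable: "good S L R \<in> sets M"
proof (rule window_set_measurable)
  show "window_set R (good S L R)"
    unfolding window_set_def
  proof (intro conjI ballI impI)
    fix x y assume x: "x \<in> good S L R" and y: "y \<in> X" "\<forall>i\<in>{- int R..int R}. y i = x i"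
    then obtain k where k: "k \<in> {L..R}" "map (\<lambda>i. x (int i - int k)) [0..<Suc k] \<in> initial_words S k"
      by (auto simp: good_def)
    have "map (\<lambda>i. y (int i - int k)) [0..<Suc k] = map (\<lambda>i. x (int i - int k)) [0..<Suc k]"
      using k(1) y(2) by (intro map_cong refl) (auto simp del: upt_Suc)
    with k(2) have "map (\<lambda>i. y (int i - int k)) [0..<Suc k] \<in> initial_words S k"
      by (simp only:)
    then show "y \<in> good S L R"
      using y(1) k(1) unfolding good_def by blast
  qed (auto simp: good_def)
qed

text \<open>Shadowing supplies a block of index at least \<open>L\<close> at almost every point, so
  the bad sets, which decrease in \<open>R\<close>, have a null intersection.\<close>

lemma measure_bad_tendsto:
  assumes "measure_shadowed_by S M"
  shows "(\<lambda>R. measure M (X - good S L R)) \<longlonglongrightarrow> 0"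
proof -
  have meas: "X - good S L R \<in> sets M" for R
    using good_measurable sets.top[of M] by (auto simp: space_eq)
  have "(\<lambda>R. measure M (X - good S L R)) \<longlonglongrightarrow> measure M (\<Inter>R. X - good S L R)"
    using meas by (intro finite_Lim_measure_decseq) (auto simp: decseq_def good_def)
  moreover have "AE x in M. x \<notin> (\<Inter>R. X - good S L R)"
    using assms[unfolded measure_shadowed_by_def] AE_space
  proof eventually_elim
    case (elim x)
    then obtain n B where n: "n \<ge> L" "B \<in> S" "\<forall>k\<le>n. B k = x (int k - int n)"
      unfolding shadowed_by_def by blast
    have "map (\<lambda>i. x (int i - int n)) [0..<Suc n] = map B [0..<Suc n]"
      using n(3) by (intro map_cong refl) (auto simp del: upt_Suc)
    then have "map (\<lambda>i. x (int i - int n)) [0..<Suc n] \<in> initial_words S n"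
      using n(2) unfolding initial_words_def by blast
    then have "x \<in> good S L n"
      using n(1) elim(2) unfolding good_def space_eq by (intro CollectI conjI bexI[of _ n]) simp_all
    then show ?case by auto
  qed
  then have "measure M (\<Inter>R. X - good S L R) = 0"
    using meas by (subst prob_eq_0[OF sets.countable_INT]) auto
  ultimately show ?thesis by simp
qed

end

subsection \<open>Coding itineraries by shadowing blocks\<close>

lemma sum_geometric_tail_le:
  fixes r :: real
  assumes "0 \<le> r" "r < 1"
  shows "(\<Sum>k=L..n. r ^ k) \<le> r ^ L / (1 - r)"
proof (cases "L \<le> n")
  case True
  have "(\<Sum>k=L..n. r ^ k) = (r ^ L - r ^ Suc n) / (1 - r)"
    using assms True by (simp add: sum_gp)
  also have "\<dots> \<le> r ^ L / (1 - r)"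
    using assms by (intro divide_right_mono) auto
  finally show ?thesis .
qed (use assms in simp)

text \<open>\<open>growth\<close> is the form in which \<open>htop S \<le> h\<close> enters;
  \<open>\<epsilon>\<close> is a slack that is removed at the very end.\<close>

locale shadowed_partition = sequence_measure M X + invariant_partition M left_shift P
  for M :: "(int \<Rightarrow> 'a::finite) measure" and X P +
  fixes S :: "(nat \<Rightarrow> 'a) set" and h \<epsilon> :: real
  assumes shadowed: "measure_shadowed_by S M"
    and h: "h \<ge> 0" and eps: "\<epsilon> > 0"
    and growth: "eventually (\<lambda>k. real (card (initial_words S k)) \<le> exp (real k * (h + \<epsilon>))) sequentially"
begin

section \<open>Calibration of the block weights\<close>

text \<open>The weight \<open>exp (- letter_cost)\<close> of a letter is half its uniform
  probability, which leaves the other half of the mass to blocks.\<close>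

definition letter_cost :: real where "letter_cost = ln (2 * real CARD('a))"

lemma letter_cost_pos: "letter_cost > 0"
proof -
  have "real CARD('a) \<ge> 1" by (simp add: Suc_leI)
  then show ?thesis unfolding letter_cost_def by (intro ln_gt_zero) linarith
qed

lemma exp_letter_cost: "exp (- letter_cost) = 1 / (2 * real CARD('a))"
  unfolding letter_cost_def exp_minus by (simp add: inverse_eq_divide)

text \<open>Of the surplus \<open>2 * \<epsilon>\<close> in the rate, one \<open>\<epsilon>\<close>
  absorbs the slack in \<open>growth\<close> and the other makes the sum over block lengths
  geometric.\<close>

definition weight :: "nat \<Rightarrow> 'a list \<Rightarrow> real" where
  "weight L = block_weight S (exp (- letter_cost)) (h + 2 * \<epsilon>) L"

text \<open>For large \<open>k\<close> the blocks of index \<open>k\<close> together weigh at most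
  \<open>exp (- \<epsilon>) ^ k\<close>; a large \<open>L\<close> brings the geometric tail below
  1/2.\<close>

lemma weight_subprobability: "\<exists>L. \<forall>n. (\<Sum>v\<in>words UNIV n. weight L v) \<le> 1"
proof -
  define r where "r = exp (- \<epsilon>)"
  have r: "0 < r" "r < 1" using eps by (auto simp: r_def)
  have "eventually (\<lambda>L. r ^ L < (1 - r) / 2) sequentially"
    using r by (intro order_tendstoD(2)[OF LIMSEQ_realpow_zero]) auto
  moreover obtain L0 where L0:
      "\<And>k. k \<ge> L0 \<Longrightarrow> real (card (initial_words S k)) \<le> exp (real k * (h + \<epsilon>))"
    using growth by (auto simp: eventually_sequentially)
  ultimately obtain L where L: "L \<ge> L0" "r ^ L < (1 - r) / 2"
    using eventually_conj[OF eventually_ge_at_top[of L0]]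
    by (metis (no_types, lifting) eventually_happens' sequentially_bot)
  have "(\<Sum>v\<in>words UNIV n. weight L v) \<le> 1" for n
    unfolding weight_def
  proof (rule sum_block_weight_le_1)
    fix n
    have "(\<Sum>k\<in>{L..n}. real (card (initial_words S k)) * exp (- (h + 2 * \<epsilon>) * real k))
        \<le> (\<Sum>k\<in>{L..n}. exp (real k * (h + \<epsilon>)) * exp (- (h + 2 * \<epsilon>) * real k))"
      using L0 L by (intro sum_mono mult_right_mono) auto
    also have "\<dots> = (\<Sum>k\<in>{L..n}. r ^ k)"
      by (intro sum.cong refl)
        (simp add: r_def exp_add[symmetric] exp_of_nat_mult[symmetric] algebra_simps)
    also have "\<dots> \<le> r ^ L / (1 - r)" using r by (intro sum_geometric_tail_le) auto
    also have "\<dots> \<le> 1 / 2" using L(2) r by (simp add: field_simps)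
    finally show "(\<Sum>k\<in>{L..n}. real (card (initial_words S k)) * exp (- (h + 2 * \<epsilon>) * real k)) \<le> 1 / 2" .
  qed (simp_all add: exp_letter_cost)
  then show ?thesis by blast
qed

lemma weight_pos: "weight L v > 0"
  unfolding weight_def by (rule block_weight_pos) simp

text \<open>A position is charged \<open>letter_cost\<close> only if the orbit is then outside
  \<open>good S L R\<close>, or if it is one of the first \<open>R\<close>, where the block ending
  there may start to the left of the segment.\<close>

lemma weight_lower_bound:
  assumes "x \<in> X"
  shows "- ln (weight L (rev (map (\<lambda>i. x (int i)) [0..<N])))
    \<le> (h + 2 * \<epsilon>) * real N
      + letter_cost * (real R + (\<Sum>j<N. indicator (X - good S L R) ((left_shift ^^ j) x)))"
proof -
  define Bad where "Bad = {j. \<not> (\<exists>k\<in>{L..R}. k \<le> j \<and>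
    map (\<lambda>i. x (int (j - k + i))) [0..<Suc k] \<in> initial_words S k)}"
  let ?I = "\<lambda>j. indicator (X - good S L R) ((left_shift ^^ j) x) :: real"
  have "Bad \<inter> {..<N} \<subseteq> {..<R} \<union> {j\<in>{..<N}. (left_shift ^^ j) x \<in> X - good S L R}"
  proof
    fix j assume j: "j \<in> Bad \<inter> {..<N}"
    have "(left_shift ^^ j) x \<notin> good S L R" if "R \<le> j"
    proof
      assume "(left_shift ^^ j) x \<in> good S L R"
      then obtain k where k: "k \<in> {L..R}"
          "map (\<lambda>i. x (int i - int k + int j)) [0..<Suc k] \<in> initial_words S k"
        unfolding good_def left_shift_iterate by blast
      have "map (\<lambda>i. x (int i - int k + int j)) [0..<Suc k] = map (\<lambda>i. x (int (j - k + i))) [0..<Suc k]"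
        using k(1) that by (intro map_cong refl arg_cong[where f = x]) (auto simp: of_nat_diff)
      with k(2) have "map (\<lambda>i. x (int (j - k + i))) [0..<Suc k] \<in> initial_words S k"
        by (simp only:)
      moreover have "k \<le> j" using k(1) that by auto
      ultimately have "j \<notin> Bad" using k(1) unfolding Bad_def by blast
      then show False using j by simp
    qed
    moreover have "(left_shift ^^ j) x \<in> X"
      using iterate_space assms by (simp add: space_eq)
    ultimately show "j \<in> {..<R} \<union> {j\<in>{..<N}. (left_shift ^^ j) x \<in> X - good S L R}"
      using j by (cases "R \<le> j") auto
  qed
  then have "card (Bad \<inter> {..<N}) \<le> card ({..<R} \<union> {j\<in>{..<N}. (left_shift ^^ j) x \<in> X - good S L R})"
    by (intro card_mono) auto
  also have "\<dots> \<le> R + card {j\<in>{..<N}. (left_shift ^^ j) x \<in> X - good S L R}"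
    using card_Un_le[of "{..<R}"] by simp
  finally have "real (card (Bad \<inter> {..<N}))
      \<le> real R + real (card {j\<in>{..<N}. (left_shift ^^ j) x \<in> X - good S L R})"
    by (simp only: of_nat_add[symmetric] of_nat_le_iff)
  also have "real (card {j\<in>{..<N}. (left_shift ^^ j) x \<in> X - good S L R}) = (\<Sum>j<N. ?I j)"
    by (simp add: indicator_def sum.If_cases Int_def)
  finally have card: "real (card (Bad \<inter> {..<N})) \<le> real R + (\<Sum>j<N. ?I j)" .
  have "exp (- (h + 2 * \<epsilon>) * real N) * exp (- letter_cost) ^ card (Bad \<inter> {..<N})
      \<le> weight L (rev (map (\<lambda>i. x (int i)) [0..<N]))"
    unfolding weight_def Bad_def using letter_cost_pos h eps
    by (intro block_weight_lower_bound[where x = "\<lambda>i. x (int i)"]) auto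
  then have "exp (- (h + 2 * \<epsilon>) * real N - letter_cost * card (Bad \<inter> {..<N}))
      \<le> weight L (rev (map (\<lambda>i. x (int i)) [0..<N]))"
    by (simp add: exp_diff exp_minus exp_of_nat_mult[symmetric] power_inverse divide_inverse mult.commute)
  then have "- (h + 2 * \<epsilon>) * real N - letter_cost * card (Bad \<inter> {..<N})
      \<le> ln (weight L (rev (map (\<lambda>i. x (int i)) [0..<N])))"
    using weight_pos by (simp add: ln_ge_iff)
  then show ?thesis
    using mult_left_mono[OF card, of letter_cost] letter_cost_pos by (simp add: algebra_simps)
qed

section \<open>A two-stage code for itineraries\<close>

text \<open>The code is a letter segment with its block weight, followed by a channel around the
  itinerary guessed from it. Per unit of time, blocks cost \<open>h + 2 * \<epsilon>\<close>; bad
  positions, the basic price of a guess and the surcharge for wrong guesses each add at most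
  \<open>\<epsilon>\<close> on average.\<close>

lemma block_entropy_bound: "\<exists>d. \<forall>n. block_entropy n \<le> (h + 5 * \<epsilon>) * real n + d"
proof -
  obtain L where L: "\<And>n. (\<Sum>v\<in>words UNIV n. weight L v) \<le> 1"
    using weight_subprobability by blast
  \<comment> \<open>With this \<open>R\<close>, single letters at bad positions cost less than
    \<open>\<epsilon>\<close> per step on average.\<close>
  obtain R where R: "measure M (X - good S L R) < \<epsilon> / letter_cost"
    using order_tendstoD(2)[OF measure_bad_tendsto[OF shadowed], of "\<epsilon> / letter_cost" L]
      eps letter_cost_pos by (auto simp: eventually_sequentially)
  have "P \<noteq> {}" using P_part not_empty by (auto simp: partition_on_def)
  then have K: "real (card P) \<ge> 1"
    using finite_P by (simp add: Suc_leI card_gt_0_iff)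
  \<comment> \<open>A right guess gets channel probability \<open>exp (- \<epsilon>)\<close>. The
    remaining mass \<open>\<delta>\<close> is spread evenly over the cells, so a wrong guess costs
    \<open>\<eta>\<close>.\<close>
  define \<delta> where "\<delta> = 1 - exp (- \<epsilon>)"
  have \<delta>: "0 < \<delta>" "\<delta> < 1" using eps by (auto simp: \<delta>_def)
  define \<eta> where "\<eta> = ln (real (card P) / \<delta>)"
  have \<eta>: "\<eta> > 0" unfolding \<eta>_def using K \<delta> by (intro ln_gt_zero) (simp add: field_simps)
  have exp_\<eta>: "exp (- \<eta>) = \<delta> / real (card P)"
    unfolding \<eta>_def exp_minus using K \<delta> by (simp add: exp_ln)
  \<comment> \<open>\<open>\<eta>\<close> depends only on \<open>\<epsilon>\<close> and
    \<open>P\<close>, so the probability of error can now be made small relative to it.\<close>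
  obtain m f D where D: "D \<in> sets M" "measure M D < \<epsilon> / \<eta>"
      "\<And>x B. x \<in> X - D \<Longrightarrow> B \<in> P \<Longrightarrow> x \<in> B \<Longrightarrow> f (map x [- int m..int m]) = B"
    by (rule partition_approximation[OF partition divide_pos_pos[OF eps \<eta>]]) blast
  define \<kappa> where "\<kappa> B C = (if B = C then exp (- \<epsilon>) else \<delta> / real (card P))" for B C :: "(int \<Rightarrow> 'a) set"
  have \<kappa>_pos: "\<kappa> B C > 0" for B C using \<delta> K by (auto simp: \<kappa>_def)
  have \<kappa>_sum: "(\<Sum>B\<in>P. \<kappa> B C) \<le> 1" for C
  proof -
    have "(\<Sum>B\<in>P. \<kappa> B C) \<le> (\<Sum>B\<in>P. (if B = C then exp (- \<epsilon>) else 0) + \<delta> / real (card P))"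
      using \<delta> by (intro sum_mono) (auto simp: \<kappa>_def)
    also have "\<dots> \<le> exp (- \<epsilon>) + \<delta>"
      using K \<delta> finite_P \<open>P \<noteq> {}\<close> by (simp add: sum.distrib sum.delta)
    finally show ?thesis by (simp add: \<delta>_def)
  qed
  \<comment> \<open>Boundary cost: the \<open>2 * m\<close> letters read in excess of
    \<open>n\<close>, and the first \<open>R\<close> positions.\<close>
  define d where "d = 2 * real m * (h + 3 * \<epsilon>) + letter_cost * real R"
  have "block_entropy n \<le> (h + 5 * \<epsilon>) * real n + d" for n
  proof -
    \<comment> \<open>The itinerary is read at times \<open>m\<close> to \<open>m + n - 1\<close>,
      and each of its symbols needs \<open>m\<close> letters on either side.\<close>
    define N where "N = n + 2 * m"
    \<comment> \<open>Words are stored backwards; \<open>rev v\<close> restores the order, and the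
      window starting at \<open>i\<close> is centred at \<open>m + i\<close>.\<close>
    define guess where "guess v i = f (take (2 * m + 1) (drop i (rev v)))" for v i
    \<comment> \<open>Mixing over all letter words gives a sub-probability on itineraries alone; the
      single term of the true letters bounds it from below.\<close>
    define q where "q w = (\<Sum>v\<in>words UNIV N. weight L v * (\<Prod>i<n. \<kappa> (w ! i) (guess v i)))" for w
    let ?v = "\<lambda>x :: int \<Rightarrow> 'a. rev (map (\<lambda>i. x (int i)) [0..<N])"
    let ?I = "\<lambda>A j x. indicator ((left_shift ^^ j) -` A \<inter> space M) x :: real"
    define U where "U x = (h + 2 * \<epsilon>) * real N + letter_cost * (real R + (\<Sum>j<N. ?I (X - good S L R) j x))
      + (\<Sum>i<n. \<epsilon> + \<eta> * ?I D (m + i) x)" for x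
    have v_in: "?v x \<in> words UNIV N" for x by (simp add: words_def)
    have term_pos: "weight L v * (\<Prod>i<n. \<kappa> (w ! i) (guess v i)) > 0" for v w
      using weight_pos \<kappa>_pos by (intro mult_pos_pos prod_pos) auto
    have q_pos: "q w > 0" for w
      unfolding q_def using term_pos v_in by (intro sum_pos finite_words) auto
    have "(\<Sum>w\<in>words P n. q w)
        = (\<Sum>v\<in>words UNIV N. weight L v * (\<Sum>w\<in>words P n. \<Prod>i<n. \<kappa> (w ! i) (guess v i)))"
      unfolding q_def sum_distrib_left by (rule sum.swap)
    also have "\<dots> \<le> (\<Sum>v\<in>words UNIV N. weight L v * 1)"
      using \<kappa>_sum \<kappa>_pos weight_pos
      by (intro sum_mono mult_left_mono sum_words_prod_le_1) (auto intro: less_imp_le)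
    also have "\<dots> \<le> 1" using L by simp
    finally have q_sum: "(\<Sum>w\<in>words P n. q w) \<le> 1" .
    have good_sets: "X - good S L R \<in> sets M"
      using good_measurable sets.top[of M] by (auto simp: space_eq)
    have I_sets: "(left_shift ^^ j) -` A \<inter> space M \<in> sets M" if "A \<in> sets M" for A j
      by (rule measurable_sets[OF iterate_measurable that])
    have U_bound: "- ln (q (itinerary n ((left_shift ^^ m) x))) \<le> U x" if x: "x \<in> space M" for x
    proof -
      let ?w = "itinerary n ((left_shift ^^ m) x)"
      have \<kappa>: "- ln (\<kappa> (?w ! i) (guess (?v x) i)) \<le> \<epsilon> + \<eta> * ?I D (m + i) x" if i: "i < n" for i
      proof -
        let ?y = "(left_shift ^^ (m + i)) x"
        have y: "?y \<in> X" using iterate_space[OF x] by (simp add: space_eq)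
        have w: "?w ! i = atom ?y"
          using i by (simp add: itinerary_def left_shift_iterate add_ac)
        have "take (2 * m + 1) (drop i (rev (?v x))) = map ?y [- int m..int m]"
          using i by (intro nth_equalityI)
            (auto simp: left_shift_iterate nth_upto N_def intro!: arg_cong[where f = x])
        then have g: "guess (?v x) i = f (map ?y [- int m..int m])" by (simp add: guess_def)
        show ?thesis
        proof (cases "?y \<in> D")
          case True
          \<comment> \<open>Inside \<open>D\<close> the guess may be right or wrong. Both values of
            \<open>\<kappa>\<close>, namely \<open>exp (- \<epsilon>)\<close> and
            \<open>exp (- \<eta>)\<close>, satisfy this bound.\<close>
          have "exp (- \<epsilon> - \<eta>) \<le> \<kappa> (?w ! i) (guess (?v x) i)"
            using eps \<eta> by (auto simp: \<kappa>_def exp_\<eta>[symmetric])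
          then have "- \<epsilon> - \<eta> \<le> ln (\<kappa> (?w ! i) (guess (?v x) i))"
            using \<kappa>_pos by (simp add: ln_ge_iff)
          then show ?thesis using True x by simp
        next
          case False
          then have "\<kappa> (?w ! i) (guess (?v x) i) = exp (- \<epsilon>)"
            unfolding g w \<kappa>_def using D(3)[of ?y "atom ?y"] y atom_in[of ?y] in_atom[of ?y]
            by (simp add: space_eq)
          then show ?thesis using \<eta> by simp
        qed
      qed
      have "weight L (?v x) * (\<Prod>i<n. \<kappa> (?w ! i) (guess (?v x) i)) \<le> q ?w"
        unfolding q_def using v_in
        by (intro member_le_sum less_imp_le[OF term_pos] finite_words) auto
      then have "- ln (q ?w) \<le> - ln (weight L (?v x) * (\<Prod>i<n. \<kappa> (?w ! i) (guess (?v x) i)))"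
        using q_pos term_pos by simp
      also have "\<dots> = - ln (weight L (?v x)) + (\<Sum>i<n. - ln (\<kappa> (?w ! i) (guess (?v x) i)))"
      proof -
        have "\<kappa> (?w ! i) (guess (?v x) i) \<noteq> 0" for i
          using \<kappa>_pos by (rule less_imp_neq[symmetric])
        then show ?thesis
          using weight_pos[of L "?v x"] prod_pos[of "{..<n}" "\<lambda>i. \<kappa> (?w ! i) (guess (?v x) i)"] \<kappa>_pos
          by (simp add: ln_mult ln_prod sum_negf)
      qed
      also have "\<dots> \<le> U x"
        unfolding U_def
      proof (rule add_mono)
        show "(\<Sum>i<n. - ln (\<kappa> (?w ! i) (guess (?v x) i))) \<le> (\<Sum>i<n. \<epsilon> + \<eta> * ?I D (m + i) x)"
          using \<kappa> by (intro sum_mono) auto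
        have "?I (X - good S L R) j x = indicator (X - good S L R) ((left_shift ^^ j) x)" for j
          using x by (simp add: indicator_def)
        then show "- ln (weight L (?v x)) \<le> (h + 2 * \<epsilon>) * real N
            + letter_cost * (real R + (\<Sum>j<N. ?I (X - good S L R) j x))"
          using weight_lower_bound[of x L N R] x by (simp add: space_eq)
      qed
      finally show ?thesis .
    qed
    have int_I: "integrable M (?I A j)" if "A \<in> sets M" for A j
      using I_sets[OF that] by (intro integrable_real_indicator) (simp_all add: emeasure_eq_measure)
    have integral_I: "(\<integral>x. ?I A j x \<partial>M) = measure M A" if "A \<in> sets M" for A j
      using I_sets[OF that] prob_iterate_vimage[OF that] by (simp add: Int_absorb2)
    have "block_entropy n \<le> (\<integral>x. U x \<partial>M)"
    proof (rule block_entropy_le_integral[OF q_pos q_sum _ U_bound])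
      show "integrable M U"
        unfolding U_def using int_I[OF good_sets] int_I[OF D(1)] by auto
    qed
    also have "\<dots> = (h + 2 * \<epsilon>) * real N + letter_cost * (real R + real N * measure M (X - good S L R))
        + real n * (\<epsilon> + \<eta> * measure M D)"
      unfolding U_def using int_I[OF good_sets] int_I[OF D(1)] integral_I[OF good_sets] integral_I[OF D(1)]
      by (simp add: prob_space)
    also have "\<dots> \<le> (h + 2 * \<epsilon>) * real N + letter_cost * (real R + real N * (\<epsilon> / letter_cost))
        + real n * (\<epsilon> + \<eta> * (\<epsilon> / \<eta>))"
      using R D(2) letter_cost_pos \<eta> by (intro add_mono mult_left_mono order_refl) auto
    also have "\<dots> = (h + 5 * \<epsilon>) * real n + d"
      using letter_cost_pos \<eta> by (simp add: d_def N_def field_simps)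
    finally show ?thesis .
  qed
  then show ?thesis by blast
qed

lemma entropy_of_partition_bound: "entropy_of_partition M left_shift P \<le> h + 5 * \<epsilon>"
  using block_entropy_bound entropy_of_partition_le by blast

end

section \<open>Removal of the slack and supremum over partitions\<close>

theorem proposition6p6:
  fixes \<Sigma>p S :: "(nat \<Rightarrow> 'a::finite) set"
    and \<Sigma> :: "(int \<Rightarrow> 'a) set"
    and \<mu> :: "(int \<Rightarrow> 'a) measure"
  assumes "subshift \<Sigma>p"
    and "\<Sigma> = natural_extension \<Sigma>p"
    and "S \<subseteq> \<Sigma>p"
    and "borel_probability_on (subtopology sequence_topology \<Sigma>) \<mu>"
    and "invariant_measure left_shift \<mu>"
    and "measure_shadowed_by S \<mu>"
  shows "KS_entropy left_shift \<mu> \<le> htop S"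
proof -
  \<comment> \<open>As \<open>ln 0 = 0\<close>, no term is negative, so \<open>htop S\<close> is
    either infinite or a nonnegative real, as the coding argument requires of
    \<open>h\<close>.\<close>
  have "eventually (\<lambda>n. (0::ereal) \<le> ereal (1 / real n * ln (real (card (initial_words S n))))) sequentially"
  proof (intro always_eventually allI)
    fix n
    have "ln (real k) \<ge> 0" for k by (cases k) auto
    then show "(0::ereal) \<le> ereal (1 / real n * ln (real (card (initial_words S n))))"
      by simp
  qed
  from Limsup_mono[OF this] have nonneg: "htop S \<ge> 0"
    unfolding htop_def by (simp add: Limsup_const)
  show ?thesis
  proof (cases "htop S = \<infinity>")
    case False
    then obtain h where h: "htop S = ereal h" "h \<ge> 0"
      using nonneg by (cases "htop S") auto
    have "entropy_of_partition \<mu> left_shift P \<le> h" if P: "finite_measurable_partition \<mu> P" for P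
    proof (rule field_le_epsilon)
      fix e :: real assume e: "e > 0"
      \<comment> \<open>The coding bound is \<open>h + 5 * \<epsilon>\<close>.\<close>
      define \<epsilon> where "\<epsilon> = e / 5"
      have eps: "\<epsilon> > 0" using e by (simp add: \<epsilon>_def)
      have "htop S < ereal (h + \<epsilon>)" using h eps by simp
      then have "eventually (\<lambda>n. ereal (1 / real n * ln (real (card (initial_words S n)))) < ereal (h + \<epsilon>)) sequentially"
        unfolding htop_def by (rule Limsup_lessD)
      then have "eventually (\<lambda>n. real (card (initial_words S n)) \<le> exp (real n * (h + \<epsilon>))) sequentially"
        using eventually_gt_at_top[of 0]
      proof eventually_elim
        case (elim n)
        show ?case
        proof (cases "card (initial_words S n) = 0")
          case False
          have "ln (real (card (initial_words S n))) \<le> real n * (h + \<epsilon>)"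
            using elim by (simp add: field_simps)
          then have "exp (ln (real (card (initial_words S n)))) \<le> exp (real n * (h + \<epsilon>))" by simp
          then show ?thesis using False by simp
        qed simp
      qed
      note growth = this
      interpret prob_space \<mu> using assms(4) by (simp add: borel_probability_on_def)
      have "sets \<mu> = sets (borel_sigma (subtopology sequence_topology \<Sigma>))"
        using assms(4) by (simp add: borel_probability_on_def)
      then interpret shadowed_partition \<mu> \<Sigma> P S h \<epsilon>
        using assms(5,6) P h(2) eps growth by unfold_locales
      show "entropy_of_partition \<mu> left_shift P \<le> h + e"
        using entropy_of_partition_bound by (simp add: \<epsilon>_def)
    qed
    then show ?thesis unfolding KS_entropy_def h by (intro SUP_least) simp
  qed simp
qed

end
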